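(* The sets of patterns $\{123,1322\}$ and $\{132,1223\}$ are $m$-equivalent, that is, $\{123,1322\}\sim\{132,1223\}$.
   Context: A (finite, reduced) multiset is $S=1^{a_1}2^{a_2}\cdots k^{a_k}$ with $k\ge 1$ and all $a_i\ge 1$, meaning that $i$ occurs with multiplicity $a_i$. A multipermutation of $S$ is a word having exactly $a_i$ occurrences of each letter $i\in[k]=\{1,\dots,k\}$ and no other letters. A word $\pi=\pi_1\cdots\pi_n$ contains a pattern (word) $\rho=\rho_1\cdots\rho_\ell$ if there are indices $i(1)<\cdots<i(\ell)$ such that for all $a,b\in[\ell]$: $\pi_{i(a)}<\pi_{i(b)}$ iff $\rho_a<\rho_b$, and $\pi_{i(a)}>\pi_{i(b)}$ iff $\rho_a>\rho_b$; otherwise $\pi$ avoids $\rho$. For a set $P$ of patterns, $\mathrm{av}(S;P)$ is the number of multipermutations of $S$ that avoid every pattern in $P$. Two sets of patterns $P,Q$ are $m$-equivalent, written here $P\sim Q$, if $\mathrm{av}(S;P)=\mathrm{av}(S;Q)$ for every multiset $S$. *)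

theory Defs
  imports Main "HOL-Combinatorics.Multiset_Permutations"
begin

text \<open>Words are lists of natural numbers; the positions of a list are counted from 0, whereas
  letters are positive integers. A multiset \<open>1^(a 1) \<dots> k^(a k)\<close> with all multiplicities
  positive is an element of \<^typ>\<open>nat multiset\<close> whose support is \<open>{1..k}\<close>. Its
  multipermutations are the elements of \<^const>\<open>permutations_of_multiset\<close>.\<close>

definition reduced_multiset :: "nat multiset \<Rightarrow> bool" where
  "reduced_multiset S \<longleftrightarrow> (\<exists>k\<ge>1. set_mset S = {1..k})"

definition contains_pattern :: "nat list \<Rightarrow> nat list \<Rightarrow> bool" where
  "contains_pattern w p \<longleftrightarrow>
     (\<exists>f :: nat \<Rightarrow> nat.
        strict_mono_on {..<length p} f \<and>
        (\<forall>a < length p. f a < length w) \<and>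
        (\<forall>a < length p. \<forall>b < length p.
           (w ! f a < w ! f b \<longleftrightarrow> p ! a < p ! b) \<and>
           (w ! f a > w ! f b \<longleftrightarrow> p ! a > p ! b)))"

definition avoids_pattern :: "nat list \<Rightarrow> nat list \<Rightarrow> bool" where
  "avoids_pattern w p \<longleftrightarrow> \<not> contains_pattern w p"

definition av :: "nat multiset \<Rightarrow> nat list set \<Rightarrow> nat" where
  "av S P = card {w \<in> permutations_of_multiset S. \<forall>p\<in>P. avoids_pattern w p}"

definition m_equivalent :: "nat list set \<Rightarrow> nat list set \<Rightarrow> bool" where
  "m_equivalent P Q \<longleftrightarrow> (\<forall>S. reduced_multiset S \<longrightarrow> av S P = av S Q)"

end

theory Submission
  imports Defs "HOL-Library.Sublist"
begin

text \<open>The proof is the multiset version of the Simion--Schmidt bijection. Call a letter of a word a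
  top if some smaller letter precedes it; the other letters are the weak left-to-right minima. A word
  avoids 123 iff every top is at least as large as all later letters, and it avoids 132 iff every top
  is the least letter, among itself and the later ones, that exceeds the minimum before it. Hence in
  both classes a word is determined by its content and its shape, that is, the positions and values
  of its weak left-to-right minima, and every shape that occurs for some word of the given content
  occurs in both classes.

  For a letter \<open>b\<close>, let \<open>v\<close> be the suffix of \<open>w\<close> that starts with the first letter below \<open>b\<close>. If
  \<open>w\<close> avoids 123, it contains 1322 with \<open>b\<close> in the role of 2 iff \<open>v\<close> has two letters \<open>b\<close> and some
  letter above \<open>b\<close>; if \<open>w\<close> avoids 132, the same condition characterises the occurrences of 1223.
  Before \<open>v\<close> every top exceeds \<open>b\<close>, so the numbers of letters equal to \<open>b\<close> and above \<open>b\<close> in \<open>v\<close>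
  depend only on shape and content, and the bijection preserves the condition.\<close>

section \<open>Patterns and subsequences\<close>

lemma subseq_imp_strict_mono_on:
  "subseq v w \<Longrightarrow>
     \<exists>f. strict_mono_on {..<length v} f \<and> (\<forall>a<length v. f a < length w \<and> w ! f a = v ! a)"
proof (induction rule: list_emb.induct)
  case (list_emb_Nil ys)
  show ?case by (simp add: strict_mono_on_def)
next
  case (list_emb_Cons xs ys y)
  then obtain f where "strict_mono_on {..<length xs} f"
    and "\<forall>a<length xs. f a < length ys \<and> ys ! f a = xs ! a"
    by blast
  then show ?case
    by (intro exI[of _ "Suc \<circ> f"]) (simp add: strict_mono_on_def)
next
  case (list_emb_Cons2 x y xs ys)
  then obtain f where f: "strict_mono_on {..<length xs} f"
    "\<forall>a<length xs. f a < length ys \<and> ys ! f a = xs ! a"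
    by blast
  let ?g = "case_nat 0 (Suc \<circ> f)"
  have "strict_mono_on {..<length (x # xs)} ?g"
    using f(1) by (auto simp: strict_mono_on_def split: nat.split)
  moreover have "\<forall>a<length (x # xs). ?g a < length (y # ys) \<and> (y # ys) ! ?g a = (x # xs) ! a"
    using f(2) list_emb_Cons2.hyps by (auto split: nat.split)
  ultimately show ?case by blast
qed

text \<open>Induction from the right keeps \<open>f\<close> fixed: the last letter sits at position
  \<open>f (length v)\<close>, and the other letters fit into the prefix before it.\<close>

lemma strict_mono_on_imp_subseq:
  assumes "strict_mono_on {..<length v} f" "\<forall>a<length v. f a < length w \<and> w ! f a = v ! a"
  shows "subseq v w"
  using assms
proof (induction v arbitrary: w rule: rev_induct)
  case Nil
  show ?case by simp
next
  case (snoc x v)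
  let ?n = "f (length v)"
  have n: "?n < length w" "w ! ?n = x" using snoc.prems(2) by auto
  have below: "f a < ?n" if "a < length v" for a
    using snoc.prems(1) that by (auto simp: strict_mono_on_def)
  have "\<forall>a<length v. f a < length (take ?n w) \<and> take ?n w ! f a = v ! a"
  proof (intro allI impI)
    fix a assume "a < length v"
    with snoc.prems(2)[rule_format, of a] below[of a] n(1)
    show "f a < length (take ?n w) \<and> take ?n w ! f a = v ! a"
      by (simp add: nth_append)
  qed
  moreover have "strict_mono_on {..<length v} f"
    using snoc.prems(1) by (auto simp: strict_mono_on_def)
  ultimately have "subseq v (take ?n w)" by (rule snoc.IH[rotated])
  moreover have "subseq [x] (x # drop (Suc ?n) w)" by simp
  ultimately have "subseq (v @ [x]) (take ?n w @ x # drop (Suc ?n) w)"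
    by (rule list_emb_append_mono)
  then show ?case using id_take_nth_drop[OF n(1)] n(2) by simp
qed

lemma contains_pattern_iff_subseq:
  "contains_pattern w p \<longleftrightarrow>
     (\<exists>v. length v = length p \<and> subseq v w \<and>
        (\<forall>a<length p. \<forall>b<length p. (v ! a < v ! b \<longleftrightarrow> p ! a < p ! b)))"
proof
  assume "contains_pattern w p"
  then obtain f where f: "strict_mono_on {..<length p} f" "\<forall>a<length p. f a < length w"
    "\<forall>a<length p. \<forall>b<length p. (w ! f a < w ! f b \<longleftrightarrow> p ! a < p ! b)"
    unfolding contains_pattern_def by blast
  let ?v = "map (\<lambda>a. w ! f a) [0..<length p]"
  have "subseq ?v w" by (rule strict_mono_on_imp_subseq[of _ f]) (use f in auto)
  then show "\<exists>v. length v = length p \<and> subseq v w \<and>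
      (\<forall>a<length p. \<forall>b<length p. (v ! a < v ! b \<longleftrightarrow> p ! a < p ! b))"
    using f(3) by (intro exI[of _ ?v]) auto
next
  assume "\<exists>v. length v = length p \<and> subseq v w \<and>
      (\<forall>a<length p. \<forall>b<length p. (v ! a < v ! b \<longleftrightarrow> p ! a < p ! b))"
  then obtain v where v: "length v = length p" "subseq v w"
    "\<forall>a<length p. \<forall>b<length p. (v ! a < v ! b \<longleftrightarrow> p ! a < p ! b)"
    by blast
  obtain f where "strict_mono_on {..<length p} f"
    "\<forall>a<length p. f a < length w \<and> w ! f a = v ! a"
    using subseq_imp_strict_mono_on[OF v(2)] v(1) by auto
  then show "contains_pattern w p"
    unfolding contains_pattern_def using v(3) by (intro exI[of _ f]) auto
qed

lemma subseq_mset: "subseq u v \<Longrightarrow> mset u \<subseteq># mset v"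
  by (induction rule: list_emb.induct) (auto intro: subset_mset.order_trans)

lemma subseq_set: "subseq u v \<Longrightarrow> set u \<subseteq> set v"
  using set_mset_mono[OF subseq_mset] by simp

lemma ex_list3:
  "(\<exists>v. length v = Suc (Suc (Suc 0)) \<and> P v) \<longleftrightarrow> (\<exists>x y z. P [x, y, z])"
  by (simp add: length_Suc_conv) blast

lemma ex_list4:
  "(\<exists>v. length v = Suc (Suc (Suc (Suc 0))) \<and> P v) \<longleftrightarrow> (\<exists>x y z u. P [x, y, z, u])"
  by (simp add: length_Suc_conv) blast

lemma contains_123:
  "contains_pattern w [1, 2, 3] \<longleftrightarrow> (\<exists>a b c. subseq [a, b, c] w \<and> a < b \<and> b < c)"
  unfolding contains_pattern_iff_subseq
  by (simp add: ex_list3 All_less_Suc) (intro ex_cong1, auto)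

lemma contains_132:
  "contains_pattern w [1, 3, 2] \<longleftrightarrow> (\<exists>a c b. subseq [a, c, b] w \<and> a < b \<and> b < c)"
  unfolding contains_pattern_iff_subseq
  by (simp add: ex_list3 All_less_Suc) (intro ex_cong1, auto)

lemma contains_1322:
  "contains_pattern w [1, 3, 2, 2] \<longleftrightarrow> (\<exists>a c b. subseq [a, c, b, b] w \<and> a < b \<and> b < c)"
proof -
  \<comment> \<open>Comparisons by \<open><\<close> alone express the two equal letters as
    \<open>b \<le> b'\<close> and \<open>b' \<le> b\<close>; antisymmetry then merges them.\<close>
  have "contains_pattern w [1, 3, 2, 2] \<longleftrightarrow>
    (\<exists>a c b b'. subseq [a, c, b, b'] w \<and> a < b \<and> b < c \<and> b \<le> b' \<and> b' \<le> b)"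
    unfolding contains_pattern_iff_subseq
    by (simp add: ex_list4 All_less_Suc) (intro ex_cong1, auto)
  then show ?thesis by (metis order.antisym order.refl)
qed

lemma contains_1223:
  "contains_pattern w [1, 2, 2, 3] \<longleftrightarrow> (\<exists>a b c. subseq [a, b, b, c] w \<and> a < b \<and> b < c)"
proof -
  have "contains_pattern w [1, 2, 2, 3] \<longleftrightarrow>
    (\<exists>a b b' c. subseq [a, b, b', c] w \<and> a < b \<and> b < c \<and> b \<le> b' \<and> b' \<le> b)"
    unfolding contains_pattern_iff_subseq
    by (simp add: ex_list4 All_less_Suc) (intro ex_cong1, auto)
  then show ?thesis by (metis order.antisym order.refl)
qed

section \<open>Shapes and greedy words\<close>

text \<open>The parameter \<open>m\<close> is the minimum of the letters read so far; at the start, any upper bound of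
  the letters will do.\<close>

fun shape :: "nat \<Rightarrow> nat list \<Rightarrow> nat option list" where
  "shape m [] = []"
| "shape m (x # xs) = (if x \<le> m then Some x # shape x xs else None # shape m xs)"

text \<open>The relation \<open>sel m x y\<close> says that, above the minimum \<open>m\<close>, the top \<open>x\<close> may be placed before
  the letter \<open>y\<close>.\<close>

fun greedy :: "(nat \<Rightarrow> nat \<Rightarrow> nat \<Rightarrow> bool) \<Rightarrow> nat \<Rightarrow> nat list \<Rightarrow> bool" where
  "greedy sel m [] \<longleftrightarrow> True"
| "greedy sel m (x # xs) \<longleftrightarrow>
     (if x \<le> m then greedy sel x xs else (\<forall>y\<in>set xs. sel m x y) \<and> greedy sel m xs)"

text \<open>The first \<open>s\<close> is replaced by \<open>t\<close>. The running minimum there is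
  at most \<open>m\<close>, so both letters are tops, and the shape records no value for a
  top.\<close>

lemma shape_replace:
  assumes "s \<in> set w" "m < s" "m < t"
  shows "\<exists>w'. shape m w' = shape m w \<and> add_mset s (mset w') = add_mset t (mset w)"
  using assms
proof (induction w arbitrary: m)
  case Nil
  then show ?case by simp
next
  case (Cons x xs)
  show ?case
  proof (cases "x = s")
    case True
    then show ?thesis using Cons.prems
      by (intro exI[of _ "t # xs"]) (auto simp: add_mset_commute)
  next
    case False
    let ?m = "min m x"
    have "s \<in> set xs" "?m < s" "?m < t" using False Cons.prems by auto
    from Cons.IH[OF this] obtain w' where
      w': "shape ?m w' = shape ?m xs" "add_mset s (mset w') = add_mset t (mset xs)"
      by blast
    have "shape m (x # w') = shape m (x # xs)"
      using w'(1) by (auto simp: min_def split: if_splits)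
    moreover have "add_mset s (mset (x # w')) = add_mset t (mset (x # xs))"
      using w'(2) by (simp add: add_mset_commute)
    ultimately show ?thesis by blast
  qed
qed

text \<open>\<open>sel_mono\<close> makes it enough to test a top against the running minimum;
  \<open>sel_antisym\<close> yields uniqueness and \<open>sel_exists\<close> existence of a greedy
  word with given shape and content.\<close>

locale selection =
  fixes sel :: "nat \<Rightarrow> nat \<Rightarrow> nat \<Rightarrow> bool"
  assumes sel_mono: "sel m x y \<Longrightarrow> m \<le> m' \<Longrightarrow> sel m' x y"
    and sel_antisym: "sel m x y \<Longrightarrow> sel m y x \<Longrightarrow> m < x \<Longrightarrow> m < y \<Longrightarrow> x = y"
    and sel_exists: "finite X \<Longrightarrow> t \<in> X \<Longrightarrow> m < t \<Longrightarrow> \<exists>s\<in>X. m < s \<and> (\<forall>y\<in>X. sel m s y)"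
begin

text \<open>The prefixed \<open>m\<close> acts as a letter already read. By \<open>sel_mono\<close>,
  a violation persists when its first letter is replaced by a smaller one, so the running minimum
  may always play that role.\<close>

lemma greedy_iff_subseq:
  "greedy sel m w \<longleftrightarrow> \<not> (\<exists>a x y. subseq [a, x, y] (m # w) \<and> a < x \<and> \<not> sel a x y)"
proof (induction w arbitrary: m)
  case Nil
  show ?case by auto
next
  case (Cons z zs)
  let ?bad = "\<lambda>w. \<exists>a x y. subseq [a, x, y] w \<and> a < x \<and> \<not> sel a x y"
  show ?case
  proof (cases "z \<le> m")
    case True
    have "?bad (m # z # zs) \<longleftrightarrow> ?bad (z # zs)"
    proof
      assume "?bad (m # z # zs)"
      then obtain a x y where s: "subseq [a, x, y] (m # z # zs)" "a < x" "\<not> sel a x y"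
        by blast
      show "?bad (z # zs)"
      proof (cases "subseq [a, x, y] (z # zs)")
        case False
        then have "a = m" "subseq [x, y] (z # zs)"
          using s(1) by (auto split: if_splits)
        then have "subseq [x, y] zs" using s(2) True by (auto split: if_splits)
        then have "subseq [z, x, y] (z # zs)" by simp
        moreover have "z < x" "\<not> sel z x y" using s \<open>a = m\<close> True sel_mono by auto
        ultimately show ?thesis by blast
      qed (use s in blast)
    qed (blast intro: list_emb_Cons)
    then show ?thesis using True Cons.IH[of z] by simp
  next
    case False
    have "?bad (m # z # zs) \<longleftrightarrow> (\<exists>y\<in>set zs. \<not> sel m z y) \<or> ?bad (m # zs)"
    proof
      assume "?bad (m # z # zs)"
      then obtain a x y where s: "subseq [a, x, y] (m # z # zs)" "a < x" "\<not> sel a x y"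
        by blast
      consider (mz) "a = m" "x = z" "y \<in> set zs" | (m) "a = m" "subseq [x, y] zs"
        | (z) "a = z" "subseq [x, y] zs" | (zs) "subseq [a, x, y] zs"
        using s(1) by (auto split: if_splits simp: subseq_singleton_left)
      then show "(\<exists>y\<in>set zs. \<not> sel m z y) \<or> ?bad (m # zs)"
      proof cases
        case mz
        then show ?thesis using s by blast
      next
        case m
        then have "subseq [a, x, y] (m # zs)" by simp
        then show ?thesis using s by blast
      next
        case z
        then have "subseq [m, x, y] (m # zs)" by simp
        moreover have "m < x" "\<not> sel m x y" using z s False sel_mono[of m x y z] by auto
        ultimately show ?thesis by blast
      next
        case zs
        then have "subseq [a, x, y] (m # zs)" by (rule list_emb_Cons)
        then show ?thesis using s by blast
      qed
    next
      assume "(\<exists>y\<in>set zs. \<not> sel m z y) \<or> ?bad (m # zs)"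
      then show "?bad (m # z # zs)"
      proof
        assume "\<exists>y\<in>set zs. \<not> sel m z y"
        then obtain y where "y \<in> set zs" "\<not> sel m z y" by blast
        then show ?thesis using False
          by (intro exI[of _ m] exI[of _ z] exI[of _ y]) (auto simp: subseq_singleton_left)
      next
        have "subseq (m # zs) (m # z # zs)" by (simp add: list_emb_Cons)
        moreover assume "?bad (m # zs)"
        ultimately show ?thesis by (meson subseq_order.order_trans)
      qed
    qed
    then show ?thesis using False Cons.IH[of m] by simp
  qed
qed

text \<open>No letter exceeds \<open>M\<close>, so the prefixed \<open>M\<close> cannot start a
  forbidden triple.\<close>

lemma greedy_iff_subseq_bounded:
  assumes "\<forall>x\<in>set w. x \<le> M"
  shows "greedy sel M w \<longleftrightarrow> \<not> (\<exists>a x y. subseq [a, x, y] w \<and> a < x \<and> \<not> sel a x y)"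
proof -
  have "subseq [a, x, y] (M # w) \<longleftrightarrow> subseq [a, x, y] w" if "a < x" for a x y
  proof
    assume *: "subseq [a, x, y] (M # w)"
    have "a \<noteq> M"
    proof
      assume "a = M"
      then have "subseq [x, y] w" using * by simp
      then have "x \<in> set w" using subseq_set by fastforce
      then show False using assms that \<open>a = M\<close> by auto
    qed
    then show "subseq [a, x, y] w" using * by simp
  qed (rule list_emb_Cons)
  then show ?thesis unfolding greedy_iff_subseq by blast
qed

text \<open>Built from the left: minima stay, and a top \<open>x\<close> gives way to a selected
  letter \<open>s\<close> while \<open>x\<close> takes the place of an \<open>s\<close> in the tail
  (\<open>shape_replace\<close>). The tail changes, hence the induction on length.\<close>

lemma greedy_exists:
  "\<exists>w'. shape m w' = shape m w \<and> mset w' = mset w \<and> greedy sel m w'"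
proof (induction "length w" arbitrary: m w)
  case 0
  then show ?case by auto
next
  case (Suc n)
  then obtain x xs where w: "w = x # xs" "length xs = n" by (metis length_Suc_conv)
  show ?case
  proof (cases "x \<le> m")
    case True
    from Suc.hyps(1)[of xs x] w obtain w' where
      "shape x w' = shape x xs" "mset w' = mset xs" "greedy sel x w'" by auto
    then show ?thesis using True w by (intro exI[of _ "x # w'"]) auto
  next
    case False
    then have "\<exists>s\<in>set w. m < s \<and> (\<forall>y\<in>set w. sel m s y)"
      using w by (intro sel_exists[of _ x]) auto
    then obtain s where s: "s \<in> set w" "m < s" "\<forall>y\<in>set w. sel m s y"
      by blast
    obtain v where v: "shape m v = shape m xs" "add_mset s (mset v) = add_mset x (mset xs)"
    proof (cases "s = x")
      case False
      then show ?thesis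
        using that shape_replace[of s xs m x] s w \<open>\<not> x \<le> m\<close> by auto
    qed (use that in auto)
    have "length v = n" using arg_cong[OF v(2), of size] w by simp
    with Suc.hyps(1)[of v m] obtain w' where
      w': "shape m w' = shape m v" "mset w' = mset v" "greedy sel m w'" by auto
    have eq: "mset (s # w') = mset w" using v w w' by simp
    then have "set w' \<subseteq> set w" by (metis set_mset_mset set_subset_Cons)
    then show ?thesis using s w w' v eq False by (intro exI[of _ "s # w'"]) auto
  qed
qed

text \<open>The shape prescribes every minimum. If two tops at the same place differed, each would
  occur later in the other word, against \<open>sel_antisym\<close>.\<close>

lemma greedy_unique:
  assumes "greedy sel m w" "greedy sel m w'" "shape m w = shape m w'" "mset w = mset w'"
  shows "w = w'"
  using assms
proof (induction w arbitrary: m w')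
  case Nil
  then show ?case by simp
next
  case (Cons x xs)
  from Cons.prems(4) obtain x' xs' where w': "w' = x' # xs'" by (cases w') auto
  show ?case
  proof (cases "x \<le> m")
    case True
    then show ?thesis using Cons.prems Cons.IH[of x xs'] w' by (auto split: if_splits)
  next
    case False
    then have m: "m < x" "m < x'" using Cons.prems(3) w' by (auto split: if_splits)
    have "x = x'"
    proof (rule ccontr)
      assume "x \<noteq> x'"
      then have "x' \<in> set xs" "x \<in> set xs'"
        using Cons.prems(4) w' mset_eq_setD[OF Cons.prems(4)] by auto
      then have "sel m x x'" "sel m x' x" using Cons.prems w' m by auto
      then show False using sel_antisym m \<open>x \<noteq> x'\<close> by blast
    qed
    then show ?thesis using Cons.prems Cons.IH[of m xs'] w' m by auto
  qed
qed

end

text \<open>By uniqueness, \<open>shape M\<close> is injective on both sets; by existence and the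
  invariance of \<open>Q\<close>, the images coincide.\<close>

lemma card_greedy_eq:
  assumes "selection sel1" "selection sel2"
    and inv: "\<And>w w'. mset w = S \<Longrightarrow> mset w' = S \<Longrightarrow> shape M w = shape M w' \<Longrightarrow> Q w \<longleftrightarrow> Q w'"
  shows "card {w. mset w = S \<and> greedy sel1 M w \<and> Q w} =
         card {w. mset w = S \<and> greedy sel2 M w \<and> Q w}"
proof -
  interpret s1: selection sel1 by fact
  interpret s2: selection sel2 by fact
  let ?A = "{w. mset w = S \<and> greedy sel1 M w \<and> Q w}"
  let ?B = "{w. mset w = S \<and> greedy sel2 M w \<and> Q w}"
  have "card ?A = card (shape M ` ?A)"
    by (rule card_image[symmetric], rule inj_onI) (auto intro: s1.greedy_unique)
  also have "shape M ` ?A = shape M ` ?B"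
  proof (intro equalityI image_subsetI)
    fix w assume "w \<in> ?A"
    then show "shape M w \<in> shape M ` ?B"
      using s2.greedy_exists[of M w] inv[of w] by (smt (verit) imageI mem_Collect_eq)
  next
    fix w assume "w \<in> ?B"
    then show "shape M w \<in> shape M ` ?A"
      using s1.greedy_exists[of M w] inv[of w] by (smt (verit) imageI mem_Collect_eq)
  qed
  also have "card (shape M ` ?B) = card ?B"
    by (rule card_image, rule inj_onI) (auto intro: s2.greedy_unique)
  finally show ?thesis .
qed

section \<open>The selection rules for 123 and 132\<close>

lemma selection_123: "selection (\<lambda>m x y. y \<le> x)"
proof
  fix X :: "nat set" and t m
  assume "finite X" "t \<in> X" "m < t"
  moreover from this have "Max X \<in> X" by (auto intro: Max_in)
  ultimately show "\<exists>s\<in>X. m < s \<and> (\<forall>y\<in>X. y \<le> s)"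
    by (intro bexI[of _ "Max X"]) (auto intro: less_le_trans)
qed auto

text \<open>A letter \<open>y \<le> m\<close> cannot play 2 in a 132 whose 1 is \<open>m\<close>,
  hence the guard. The selected letter is the least remaining one above \<open>m\<close>.\<close>

lemma selection_132: "selection (\<lambda>m x y. m < y \<longrightarrow> x \<le> y)"
proof
  fix X :: "nat set" and t m
  assume "finite X" "t \<in> X" "m < t"
  then have "finite {y\<in>X. m < y}" "{y\<in>X. m < y} \<noteq> {}" by auto
  then have "Min {y\<in>X. m < y} \<in> {y\<in>X. m < y}" by (rule Min_in)
  moreover have "Min {y\<in>X. m < y} \<le> y" if "y \<in> {y\<in>X. m < y}" for y
    using \<open>finite {y\<in>X. m < y}\<close> that by (rule Min_le)
  ultimately show "\<exists>s\<in>X. m < s \<and> (\<forall>y\<in>X. m < y \<longrightarrow> s \<le> y)" by blast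
qed auto

section \<open>The patterns of length four\<close>

text \<open>If no letter is below \<open>b\<close>, the suffix is empty and the condition fails, so
  a letter for the role of 1 is implicit. The order of the other letters is left free.\<close>

definition repeated_below :: "nat list \<Rightarrow> bool" where
  "repeated_below w \<longleftrightarrow>
     (\<exists>b. 2 \<le> count_list (dropWhile (\<lambda>x. b \<le> x) w) b \<and> (\<exists>c\<in>set (dropWhile (\<lambda>x. b \<le> x) w). b < c))"

text \<open>The first letter below \<open>b\<close> is a minimum, so the shape shows its position.
  Tops before it exceed a running minimum that is at least \<open>b\<close>, so every
  \<open>b\<close> there is a minimum as well.\<close>

lemma shape_takeWhile:
  assumes "shape m w = shape m w'" "b \<le> m"
  shows "length (takeWhile (\<lambda>x. b \<le> x) w) = length (takeWhile (\<lambda>x. b \<le> x) w') \<and>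
         count_list (takeWhile (\<lambda>x. b \<le> x) w) b = count_list (takeWhile (\<lambda>x. b \<le> x) w') b"
  using assms
proof (induction w arbitrary: m w')
  case Nil
  then show ?case by (cases w') (auto split: if_splits)
next
  case (Cons x xs)
  then obtain x' xs' where w': "w' = x' # xs'" by (cases w') (auto split: if_splits)
  show ?case
  proof (cases "x \<le> m")
    case True
    then show ?thesis using Cons.prems Cons.IH[of x xs'] w' by (auto split: if_splits)
  next
    case False
    then show ?thesis using Cons.prems Cons.IH[of m xs'] w' by (auto split: if_splits)
  qed
qed

lemma shape_dropWhile:
  assumes "shape m w = shape m w'" "mset w = mset w'" "b \<le> m"
  shows "count_list (dropWhile (\<lambda>x. b \<le> x) w) b = count_list (dropWhile (\<lambda>x. b \<le> x) w') b"
    and "(\<exists>c\<in>set (dropWhile (\<lambda>x. b \<le> x) w). b < c) \<longleftrightarrow> (\<exists>c\<in>set (dropWhile (\<lambda>x. b \<le> x) w'). b < c)"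
proof -
  let ?t = "takeWhile (\<lambda>x. b \<le> x)" and ?d = "dropWhile (\<lambda>x. b \<le> x)"
  let ?ge = "\<lambda>xs. length (filter (\<lambda>x. b \<le> x) xs)"
  have count_split: "count_list u b = count_list (?t u) b + count_list (?d u) b" for u
    by (metis count_list_append takeWhile_dropWhile_id)
  have ge_split: "?ge u = length (?t u) + ?ge (?d u)" for u
  proof -
    have "filter (\<lambda>x. b \<le> x) (?t u) = ?t u" by (auto simp: filter_id_conv dest: set_takeWhileD)
    then show ?thesis by (metis filter_append length_append takeWhile_dropWhile_id)
  qed
  \<comment> \<open>Counting replaces the existential: counts in the suffix are those of the whole
    word minus those of the prefix, all of whose letters are at least \<open>b\<close>.\<close>
  have ex_iff: "(\<exists>c\<in>set u. b < c) \<longleftrightarrow> count_list u b < ?ge u" for u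
  proof -
    have "?ge u = count_list u b + length (filter (\<lambda>x. b < x) u)"
      by (induction u) auto
    then show ?thesis by (auto simp: filter_empty_conv)
  qed
  have "count_list w b = count_list w' b"
    using assms(2) by (metis count_mset)
  then show count: "count_list (?d w) b = count_list (?d w') b"
    using shape_takeWhile[OF assms(1,3)] count_split[of w] count_split[of w'] by simp
  have "?ge w = ?ge w'" using assms(2) by (metis mset_filter size_mset)
  then have "?ge (?d w) = ?ge (?d w')"
    using shape_takeWhile[OF assms(1,3)] ge_split[of w] ge_split[of w'] by simp
  then show "(\<exists>c\<in>set (?d w). b < c) \<longleftrightarrow> (\<exists>c\<in>set (?d w'). b < c)"
    unfolding ex_iff using count by simp
qed

lemma shape_repeated_below:
  assumes "shape M w = shape M w'" "mset w = mset w'" "\<forall>x\<in>set w. x \<le> M"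
  shows "repeated_below w \<longleftrightarrow> repeated_below w'"
proof -
  \<comment> \<open>\<open>shape_dropWhile\<close> needs \<open>b \<le> M\<close>, which holds for
    every \<open>b\<close> occurring in the word.\<close>
  have b: "b \<le> M" if "2 \<le> count_list (dropWhile (\<lambda>x. b \<le> x) u) b" "mset u = mset w" for b u
  proof -
    have "b \<in> set (dropWhile (\<lambda>x. b \<le> x) u)"
      using that(1) by (metis count_list_0_iff not_numeral_le_zero)
    then have "b \<in> set u" by (rule set_dropWhileD)
    then show ?thesis using assms(3) mset_eq_setD[OF that(2)] by auto
  qed
  then show ?thesis
    unfolding repeated_below_def using shape_dropWhile[OF assms(1,2)] assms(2) by metis
qed

section \<open>Occurrences of 1322 and 1223\<close>

lemma subseq_dropWhile:
  "subseq (a # u) w \<Longrightarrow> a < b \<Longrightarrow> subseq (a # u) (dropWhile (\<lambda>x. b \<le> x) w)" for a b :: nat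
  by (induction w) (auto split: if_splits)

lemma subseq_pair: "2 \<le> count_list u b \<Longrightarrow> subseq [b, b] u"
proof (induction u)
  case (Cons x xs)
  have "b \<in> set xs" if "x = b"
  proof (rule ccontr)
    assume "b \<notin> set xs"
    then show False using Cons.prems that by simp
  qed
  then show ?case
    using Cons by (auto simp: subseq_singleton_left)
qed simp

text \<open>Giving \<open>u\<close> only up to order covers 1322 and 1223 at once.\<close>

lemma subseq_imp_repeated_below:
  assumes "subseq (a # u) w" "a < b" "b < c" "mset u = {#b, b, c#}"
  shows "repeated_below w"
proof -
  let ?v = "dropWhile (\<lambda>x. b \<le> x) w"
  have s: "subseq (a # u) ?v" using assms by (intro subseq_dropWhile)
  have "count_list (a # u) b = 2" using assms by (simp flip: count_mset)
  moreover have "count_list (a # u) b \<le> count_list ?v b"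
    using mset_subset_eq_count[OF subseq_mset[OF s], of b] unfolding count_mset .
  moreover have "c \<in> set ?v"
    using subseq_set[OF s] mset_eq_setD[of u "[b, b, c]"] assms(4) by auto
  ultimately show ?thesis unfolding repeated_below_def using assms by auto
qed

text \<open>The suffix starts with some \<open>a < b\<close>. Split the rest at a letter
  \<open>c\<close>: either some \<open>b\<close> lies on a given side of it, which gives a pattern
  of length three, or two copies lie on the other side.\<close>

lemma repeated_below_imp_subseq:
  assumes "repeated_below w"
  obtains a b c where "a < b" "b < c"
    "subseq [a, c, b, b] w \<or> subseq [a, b, c] w" "subseq [a, b, b, c] w \<or> subseq [a, c, b] w"
proof -
  obtain b c where b: "2 \<le> count_list (dropWhile (\<lambda>x. b \<le> x) w) b"
    and c: "c \<in> set (dropWhile (\<lambda>x. b \<le> x) w)" "b < c"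
    using assms unfolding repeated_below_def by blast
  obtain a v where v: "dropWhile (\<lambda>x. b \<le> x) w = a # v"
    using c(1) by (cases "dropWhile (\<lambda>x. b \<le> x) w") auto
  have a: "a < b" using v by (metis dropWhile_eq_Cons_conv not_le)
  have w: "subseq (a # u) w" if "subseq u v" for u
  proof -
    have "subseq (a # u) (dropWhile (\<lambda>x. b \<le> x) w)" using that v by simp
    then show ?thesis
      by (metis list_emb_append2 takeWhile_dropWhile_id)
  qed
  have "c \<in> set v" using a c v by auto
  then obtain p q where pq: "v = p @ c # q" by (meson split_list)
  have count: "2 \<le> count_list p b + count_list q b" using b v a c pq by auto
  have "subseq [c, b, b] v \<or> subseq [b, c] v"
  proof (cases "b \<in> set p")
    case True
    then have "subseq ([b] @ [c]) (p @ c # q)"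
      by (intro list_emb_append_mono) (auto simp: subseq_singleton_left)
    then show ?thesis using pq by simp
  next
    case False
    then have "subseq [b, b] q" using count by (intro subseq_pair) simp
    then show ?thesis using pq by (simp add: list_emb_append2)
  qed
  moreover have "subseq [b, b, c] v \<or> subseq [c, b] v"
  proof (cases "b \<in> set q")
    case True
    then have "subseq [c, b] (c # q)" by (simp add: subseq_singleton_left)
    then show ?thesis using pq by (simp add: list_emb_append2)
  next
    case False
    then have "subseq [b, b] p" using count by (intro subseq_pair) simp
    then have "subseq ([b, b] @ [c]) (p @ c # q)"
      by (intro list_emb_append_mono) auto
    then show ?thesis using pq by simp
  qed
  ultimately show ?thesis using that[OF a c(2)] w by blast
qed

text \<open>An occurrence of 1322 forces \<open>repeated_below\<close>; conversely,
  \<open>repeated_below\<close> gives 1322 or 123, and greediness excludes the latter.\<close>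

lemma avoids_123_1322_iff:
  assumes "\<forall>x\<in>set w. x \<le> M"
  shows "avoids_pattern w [1, 2, 3] \<and> avoids_pattern w [1, 3, 2, 2] \<longleftrightarrow>
         greedy (\<lambda>m x y. y \<le> x) M w \<and> \<not> repeated_below w"
proof -
  interpret selection "\<lambda>m x y. y \<le> x" by (rule selection_123)
  have "greedy (\<lambda>m x y. y \<le> x) M w \<longleftrightarrow> \<not> (\<exists>a b c. subseq [a, b, c] w \<and> a < b \<and> b < c)"
    by (simp add: greedy_iff_subseq_bounded[OF assms] not_le)
  moreover have "repeated_below w" if "subseq [a, c, b, b] w" "a < b" "b < c" for a b c
    using that by (auto intro: subseq_imp_repeated_below simp: add_mset_commute)
  moreover have "\<exists>a c b. (subseq [a, c, b, b] w \<or> subseq [a, b, c] w) \<and> a < b \<and> b < c"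
    if "repeated_below w"
    using that by (rule repeated_below_imp_subseq) blast
  ultimately show ?thesis
    unfolding avoids_pattern_def contains_123 contains_1322 by blast
qed

lemma avoids_132_1223_iff:
  assumes "\<forall>x\<in>set w. x \<le> M"
  shows "avoids_pattern w [1, 3, 2] \<and> avoids_pattern w [1, 2, 2, 3] \<longleftrightarrow>
         greedy (\<lambda>m x y. m < y \<longrightarrow> x \<le> y) M w \<and> \<not> repeated_below w"
proof -
  interpret selection "\<lambda>m x y. m < y \<longrightarrow> x \<le> y" by (rule selection_132)
  have "greedy (\<lambda>m x y. m < y \<longrightarrow> x \<le> y) M w \<longleftrightarrow> \<not> (\<exists>a b c. subseq [a, c, b] w \<and> a < b \<and> b < c)"
    unfolding greedy_iff_subseq_bounded[OF assms] not_imp not_le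
    by (meson less_trans)
  moreover have "repeated_below w" if "subseq [a, b, b, c] w" "a < b" "b < c" for a b c
    using that by (auto intro: subseq_imp_repeated_below)
  moreover have "\<exists>a b c. (subseq [a, b, b, c] w \<or> subseq [a, c, b] w) \<and> a < b \<and> b < c"
    if "repeated_below w"
    using that by (rule repeated_below_imp_subseq) blast
  ultimately show ?thesis
    unfolding avoids_pattern_def contains_132 contains_1223 by blast
qed

theorem theorem2p21:
  shows "m_equivalent {[1, 2, 3], [1, 3, 2, 2]} {[1, 3, 2], [1, 2, 2, 3]}"
  unfolding m_equivalent_def
proof (intro allI impI)
  fix S :: "nat multiset"
  assume "reduced_multiset S"
  \<comment> \<open>With \<open>M\<close> as initial minimum, the first letter always counts as a
    weak left-to-right minimum.\<close>
  obtain M where "\<forall>x\<in>#S. x \<le> M" by (meson Max_ge finite_set_mset)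
  then have M: "\<forall>x\<in>set w. x \<le> M" if "mset w = S" for w using that by auto
  have "av S {[1, 2, 3], [1, 3, 2, 2]} =
    card {w. mset w = S \<and> greedy (\<lambda>m x y. y \<le> x) M w \<and> \<not> repeated_below w}"
    unfolding av_def permutations_of_multiset_def
    by (simp only: mem_Collect_eq ball_simps simp_thms avoids_123_1322_iff[OF M] cong: conj_cong)
  also have "\<dots> = card {w. mset w = S \<and> greedy (\<lambda>m x y. m < y \<longrightarrow> x \<le> y) M w \<and> \<not> repeated_below w}"
  proof (rule card_greedy_eq[OF selection_123 selection_132])
    fix w w' assume "mset w = S" "mset w' = S" "shape M w = shape M w'"
    then show "\<not> repeated_below w \<longleftrightarrow> \<not> repeated_below w'"
      using shape_repeated_below[of M w w'] M by simp
  qed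
  also have "\<dots> = av S {[1, 3, 2], [1, 2, 2, 3]}"
    unfolding av_def permutations_of_multiset_def
    by (simp only: mem_Collect_eq ball_simps simp_thms avoids_132_1223_iff[OF M] cong: conj_cong)
  finally show "av S {[1, 2, 3], [1, 3, 2, 2]} = av S {[1, 3, 2], [1, 2, 2, 3]}" .
qed

end
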